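(* Let $$g_1(p)=e_1\,\frac{p(\bar\omega-p)}{\alpha}-e_2\,\frac{(\bar\omega-p)^2}{\alpha^2}-e_3\,\frac{p^2}{\alpha^2},$$ $$g_2(p)=e_1\,\frac{p(\bar\omega-p)}{\alpha}-e_2\,\frac{(\bar\omega-p)^2}{\alpha^2}-e_3\,\frac{p^2}{\alpha^2}-\frac{(p-\omega_{\min})^2}{2\alpha(\omega_{\max}-\omega_{\min})}.$$ Let $p_2^l$ be the solution of the problem of maximizing $g_1(p)$ subject to $p_b\le p\le\omega_{\min}$, and let $p_2^r$ be the solution of the problem of maximizing $g_2(p)$ subject to $\omega_{\min}\le p\le P$. Then the optimal price $p_2^*$ proposed by Formulation 2 in the asymptotic sense (defined in the context) can be obtained as follows: $p_2^*=p_2^l$ if $g_1(p_2^l)>g_2(p_2^r)$, and $p_2^*=p_2^r$ if $g_1(p_2^l)\le g_2(p_2^r)$.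
   Context: Non-discriminatory setting: a retailer charges one common unit price $p$ to $N$ consumers in a fixed time period. The preference parameters $\omega_i$ of the consumers are i.i.d. and uniformly distributed on $[\omega_{\min},\omega_{\max}]$, with expected value $\bar\omega$. $\alpha$ is a predetermined constant, $e_1,e_2,e_3$ are weight factors, and the price is constrained by $p_b\le p\le P$, where $p_b$ is the base rate and $P$ the upper price limit; the analysis treats the two intervals $[p_b,\omega_{\min}]$ and $[\omega_{\min},P]$ separately. In Formulation 2, with $x_i=\frac{\omega_i-p}{\alpha}$, the retailer maximizes, over $p_b\le p\le P$, $$f_2(p)=e_1\sum_{i=1}^N p\,x_i-\frac{e_2}{N}\Big(\sum_{i=1}^N x_i\Big)^2-e_3\sum_{i=1}^N\Big(\frac p\alpha\Big)^2+\sum_{i=1}^N\min\Big(0,\frac{\omega_i-p}{\alpha}\Big).$$ "In the asymptotic sense" means that the objective is replaced by $\lim_{N\to\infty}\frac1N f_2(p)$, evaluated by the law of large numbers by taking expectations over the distribution of the $\omega_i$.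
   Formalization: The formal statement assumes α > 0, nonnegative weight factors e1, e2, e3 and a nonnegative base rate p_b; these sign conditions are unstated in the English, and the claim can fail without them (e.g. for α < 0, or for e3 < 0 with P > ω_max). *)

theory Defs
  imports "HOL-Probability.Probability"
begin

text \<open>The consumers are numbered from 0, so the first \<open>N\<close> of them are \<open>{..<N}\<close>;
  \<open>\<omega> i\<close> is the realised preference parameter of consumer \<open>i\<close>.\<close>

definition usage :: "real \<Rightarrow> (nat \<Rightarrow> real) \<Rightarrow> real \<Rightarrow> nat \<Rightarrow> real" where
  "usage \<alpha> \<omega> p i = (\<omega> i - p) / \<alpha>"

definition f2 ::
  "real \<Rightarrow> real \<Rightarrow> real \<Rightarrow> real \<Rightarrow> (nat \<Rightarrow> real) \<Rightarrow> nat \<Rightarrow> real \<Rightarrow> real" where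
  "f2 \<alpha> e1 e2 e3 \<omega> N p =
     e1 * (\<Sum>i<N. p * usage \<alpha> \<omega> p i)
     - e2 / real N * (\<Sum>i<N. usage \<alpha> \<omega> p i)\<^sup>2
     - e3 * (\<Sum>i<N. (p / \<alpha>)\<^sup>2)
     + (\<Sum>i<N. min 0 ((\<omega> i - p) / \<alpha>))"

definition iid_uniform :: "'s measure \<Rightarrow> (nat \<Rightarrow> 's \<Rightarrow> real) \<Rightarrow> real \<Rightarrow> real \<Rightarrow> bool" where
  "iid_uniform M W a b \<longleftrightarrow>
     prob_space.indep_vars M (\<lambda>_. borel) W UNIV \<and>
     (\<forall>i. distributed M lborel (W i) (\<lambda>x. indicator {a..b} x / measure lborel {a..b}))"

text \<open>\<open>F\<close> is the limit of the per-consumer objective: for every feasible price the random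
  sequence \<open>f2 / N\<close> converges almost surely to the deterministic value \<open>F p\<close>. This determines
  \<open>F\<close> on the feasible interval.\<close>

definition asymptotic_objective ::
  "'s measure \<Rightarrow> (nat \<Rightarrow> 's \<Rightarrow> real) \<Rightarrow> real \<Rightarrow> real \<Rightarrow> real \<Rightarrow> real \<Rightarrow> real \<Rightarrow> real
    \<Rightarrow> (real \<Rightarrow> real) \<Rightarrow> bool" where
  "asymptotic_objective M W \<alpha> e1 e2 e3 p\<^sub>b P F \<longleftrightarrow>
     (\<forall>p\<in>{p\<^sub>b..P}. AE s in M.
        (\<lambda>N. 1 / real N * f2 \<alpha> e1 e2 e3 (\<lambda>i. W i s) N p) \<longlonglongrightarrow> F p)"

definition asymptotic_optimal_price ::
  "'s measure \<Rightarrow> (nat \<Rightarrow> 's \<Rightarrow> real) \<Rightarrow> real \<Rightarrow> real \<Rightarrow> real \<Rightarrow> real \<Rightarrow> real \<Rightarrow> real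
    \<Rightarrow> real \<Rightarrow> bool" where
  "asymptotic_optimal_price M W \<alpha> e1 e2 e3 p\<^sub>b P p \<longleftrightarrow>
     (\<exists>F. asymptotic_objective M W \<alpha> e1 e2 e3 p\<^sub>b P F \<and>
          is_arg_max F (\<lambda>q. q \<in> {p\<^sub>b..P}) p)"

definition g1 :: "real \<Rightarrow> real \<Rightarrow> real \<Rightarrow> real \<Rightarrow> real \<Rightarrow> real \<Rightarrow> real" where
  "g1 \<alpha> e1 e2 e3 \<omega>bar p =
     e1 * (p * (\<omega>bar - p) / \<alpha>) - e2 * ((\<omega>bar - p)\<^sup>2 / \<alpha>\<^sup>2) - e3 * (p\<^sup>2 / \<alpha>\<^sup>2)"

definition g2 ::
  "real \<Rightarrow> real \<Rightarrow> real \<Rightarrow> real \<Rightarrow> real \<Rightarrow> real \<Rightarrow> real \<Rightarrow> real \<Rightarrow> real" where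
  "g2 \<alpha> e1 e2 e3 \<omega>bar \<omega>min \<omega>max p =
     e1 * (p * (\<omega>bar - p) / \<alpha>) - e2 * ((\<omega>bar - p)\<^sup>2 / \<alpha>\<^sup>2) - e3 * (p\<^sup>2 / \<alpha>\<^sup>2)
     - (p - \<omega>min)\<^sup>2 / (2 * \<alpha> * (\<omega>max - \<omega>min))"

end

theory Submission imports Defs begin

text \<open>
  Write \<open>a = \<omega>min\<close>, \<open>b = \<omega>max\<close>. The objective per consumer is a continuous function of two
  empirical means, that of \<open>\<omega> i\<close> and that of the penalty \<open>min 0 ((\<omega> i - p) / \<alpha>)\<close>. Both are means of
  bounded i.i.d. variables, so they converge almost surely (\<open>strong_law_bounded\<close>, from Hoeffding's
  inequality and Borel--Cantelli). The limiting objective is therefore \<open>g1\<close> plus the expected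
  penalty (\<open>limit_objective\<close>): it is \<open>g1\<close> up to \<open>a\<close>, where no consumer is penalised,
  \<open>g2\<close> on \<open>[a, b]\<close>, and a third expression above \<open>b\<close>, where every consumer is penalised
  and the formula \<open>g2\<close> no longer gives the expectation.

  The third regime matters because the price cap \<open>P\<close> may exceed \<open>b\<close>. There, however, both
  the limiting objective and \<open>g2\<close> lie strictly below their common value at \<open>b\<close>, so neither has
  a maximiser above \<open>b\<close>. Hence maximising the limiting objective over \<open>[p\<^sub>b, P]\<close> is maximising
  \<open>g1\<close> on the left piece and \<open>g2\<close> on the right piece, and taking the better one.

  For uniqueness the delicate case is a tie \<open>g1 pl = g2 pr\<close>, in which both \<open>pl\<close> and \<open>pr\<close> are
  optimal. Since \<open>g1\<close> is concave and dominates \<open>g2\<close>, a tie makes the junction \<open>a\<close>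
  optimal for both pieces; uniqueness on each piece then gives \<open>pl = a = pr\<close>
  (\<open>tie_at_junction\<close>).
\<close>

section \<open>A strong law for bounded variables\<close>

text \<open>Hoeffding's bound on the probability of a deviation \<open>\<epsilon>\<close> is geometric in the number of
  variables, hence summable, and Borel--Cantelli applies; intersecting over \<open>\<epsilon> = 1 / (k + 1)\<close> turns
  this into convergence.\<close>

lemma (in prob_space) strong_law_bounded:
  fixes X :: "nat \<Rightarrow> 'a \<Rightarrow> real"
  assumes indep: "indep_vars (\<lambda>_. borel) X UNIV"
    and bounded: "\<And>i. AE x in M. X i x \<in> {a..b}"
    and mean: "\<And>i. expectation (X i) = \<mu>"
  shows "AE x in M. (\<lambda>n. (\<Sum>i<n. X i x) / real n) \<longlonglongrightarrow> \<mu>"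
proof -
  have rv [measurable]: "random_variable borel (X i)" for i
    using indep unfolding indep_vars_def by blast
  \<comment> \<open>The bounds are widened so that the denominator in Hoeffding's inequality is positive.\<close>
  define d where "d = (max a b + 1 - a)\<^sup>2"
  have "d > 0" unfolding d_def by (intro zero_less_power) auto
  have deviation: "AE x in M. \<forall>\<^sub>F n in sequentially. \<bar>(\<Sum>i<n. X i x) / real n - \<mu>\<bar> < \<epsilon>"
    if "\<epsilon> > 0" for \<epsilon> :: real
  proof -
    define A where "A n = {x \<in> space M. \<bar>(\<Sum>i<n. X i x) - real n * \<mu>\<bar> \<ge> real n * \<epsilon>}" for n
    define r where "r = exp (- 2 * \<epsilon>\<^sup>2 / d)"
    have [measurable]: "A n \<in> sets M" for n unfolding A_def by measurable
    have r: "0 < r" "r < 1" using \<open>d > 0\<close> that by (auto simp: r_def)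
    have prob_A: "prob (A n) \<le> 2 * r ^ n" if "n > 0" for n
    proof -
      interpret H: Hoeffding_ineq M "{..<n}" X "\<lambda>_. a" "\<lambda>_. max a b + 1" "real n * \<mu>"
      proof unfold_locales
        show "indep_vars (\<lambda>_. borel) X {..<n}"
          by (rule indep_vars_subset[OF indep]) auto
        show "AE x in M. X i x \<in> {a..max a b + 1}" for i
          using bounded[of i] by eventually_elim auto
        show "real n * \<mu> \<equiv> \<Sum>i<n. expectation (X i)" by (simp add: mean)
      qed auto
      have sq: "(\<Sum>i<n. (max a b + 1 - a)\<^sup>2) = real n * d" by (simp add: d_def)
      have "prob (A n) \<le> 2 * exp (- 2 * (real n * \<epsilon>)\<^sup>2 / (real n * d))"
        using H.Hoeffding_ineq_abs_ge[of "real n * \<epsilon>"] that \<open>\<epsilon> > 0\<close> \<open>d > 0\<close>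
        unfolding A_def sq by simp
      also have "- 2 * (real n * \<epsilon>)\<^sup>2 / (real n * d) = real n * (- 2 * \<epsilon>\<^sup>2 / d)"
        using that by (simp add: power2_eq_square field_simps)
      also have "exp \<dots> = r ^ n" unfolding r_def by (rule exp_of_nat_mult)
      finally show ?thesis .
    qed
    have "summable (\<lambda>n. prob (A n))"
    proof (rule summable_comparison_test_ev)
      show "\<forall>\<^sub>F n in sequentially. norm (prob (A n)) \<le> 2 * r ^ n"
        using eventually_gt_at_top[of 0] by eventually_elim (use prob_A in auto)
      show "summable (\<lambda>n. 2 * r ^ n)" using r by (intro summable_mult summable_geometric) auto
    qed
    then have "AE x in M. \<forall>\<^sub>F n in sequentially. x \<in> space M - A n"
      by (intro borel_cantelli_AE1) (auto simp: emeasure_eq_measure)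
    then show ?thesis
    proof eventually_elim
      case (elim x)
      from elim eventually_gt_at_top[of 0] show ?case
      proof eventually_elim
        case (elim n)
        then have "\<bar>(\<Sum>i<n. X i x) - real n * \<mu>\<bar> < real n * \<epsilon>" by (auto simp: A_def)
        moreover have "(\<Sum>i<n. X i x) / real n - \<mu> = ((\<Sum>i<n. X i x) - real n * \<mu>) / real n"
          using elim by (simp add: field_simps)
        ultimately show ?case using elim by (simp add: abs_divide field_simps)
      qed
    qed
  qed
  have "AE x in M. \<forall>k. \<forall>\<^sub>F n in sequentially.
      \<bar>(\<Sum>i<n. X i x) / real n - \<mu>\<bar> < 1 / real (Suc k)"
    unfolding AE_all_countable by (intro allI deviation) simp
  then show ?thesis
  proof eventually_elim
    case (elim x)
    show ?case
    proof (rule tendstoI)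
      fix e :: real assume "e > 0"
      then obtain k where k: "1 / real (Suc k) < e" using nat_approx_posE by blast
      from elim[rule_format, of k]
      show "\<forall>\<^sub>F n in sequentially. dist ((\<Sum>i<n. X i x) / real n) \<mu> < e"
        by eventually_elim (use k in \<open>simp add: dist_real_def\<close>)
    qed
  qed
qed

section \<open>Expected penalty under the uniform distribution\<close>

definition expected_penalty :: "real \<Rightarrow> real \<Rightarrow> real \<Rightarrow> real \<Rightarrow> real" where
  "expected_penalty \<alpha> a b p =
     (if p \<le> a then 0
      else if p \<le> b then - ((p - a)\<^sup>2 / (2 * \<alpha> * (b - a)))
      else ((a + b) / 2 - p) / \<alpha>)"

lemma (in prob_space) uniform_AE_bounds:
  fixes a b :: real
  assumes D: "distributed M lborel X (\<lambda>x. indicator {a..b} x / measure lborel {a..b})"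
  shows "AE s in M. X s \<in> {a..b}"
proof -
  have "AE x in lborel. 0 < ennreal (indicator {a..b} x / measure lborel {a..b}) \<longrightarrow> x \<in> {a..b}"
    by (auto split: split_indicator)
  then show ?thesis by (subst distributed_AE2[OF D]) auto
qed

lemma (in prob_space) uniform_expected_penalty:
  fixes a b :: real
  assumes D: "distributed M lborel X (\<lambda>x. indicator {a..b} x / measure lborel {a..b})"
    and "\<alpha> > 0"
  shows "expectation (\<lambda>s. min 0 ((X s - p) / \<alpha>)) = expected_penalty \<alpha> a b p"
proof -
  have ab: "a < b" using uniform_distributed_bounds[OF D] .
  have rv [measurable]: "random_variable borel X"
    using distributed_measurable[OF D] by simp
  note bounds = uniform_AE_bounds[OF D]
  consider "p \<le> a" | "a < p" "p \<le> b" | "b < p" by linarith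
  then show ?thesis
  proof cases
    case 1
    have "expectation (\<lambda>s. min 0 ((X s - p) / \<alpha>)) = expectation (\<lambda>s. 0)"
    proof (rule integral_cong_AE)
      show "AE s in M. min 0 ((X s - p) / \<alpha>) = 0"
        using bounds by eventually_elim (use 1 \<open>\<alpha> > 0\<close> in \<open>auto simp: min_def field_simps\<close>)
    qed auto
    then show ?thesis using 1 by (simp add: expected_penalty_def)
  next
    case 2
    have "expectation (\<lambda>s. min 0 ((X s - p) / \<alpha>)) =
        (\<integral>x. indicator {a..b} x / measure lborel {a..b} * min 0 ((x - p) / \<alpha>) \<partial>lborel)"
      by (subst distributed_integral[OF D]) auto
    \<comment> \<open>Only \<open>x \<le> p\<close> contributes, so the integrand is smooth on the effective range \<open>{a..p}\<close>.\<close>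
    also have "\<dots> = (\<integral>x. (x - p) / (\<alpha> * (b - a)) * indicator {a..p} x \<partial>lborel)"
      using ab 2 \<open>\<alpha> > 0\<close>
      by (intro Bochner_Integration.integral_cong)
         (auto simp: min_def field_simps split: split_indicator)
    also have "\<dots> = (p - p)\<^sup>2 / (2 * \<alpha> * (b - a)) - (a - p)\<^sup>2 / (2 * \<alpha> * (b - a))"
    proof (rule integral_FTC_Icc_real)
      fix x
      have "((\<lambda>x. (x - p)\<^sup>2 / (2 * \<alpha> * (b - a))) has_real_derivative
          2 * (x - p) / (2 * \<alpha> * (b - a))) (at x)"
        by (rule DERIV_cdivide) (auto intro!: derivative_eq_intros)
      then show "((\<lambda>x. (x - p)\<^sup>2 / (2 * \<alpha> * (b - a))) has_real_derivative
          (x - p) / (\<alpha> * (b - a))) (at x)"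
        by (simp only: mult.assoc mult_divide_mult_cancel_left[OF zero_neq_numeral[symmetric]])
      show "isCont (\<lambda>x. (x - p) / (\<alpha> * (b - a))) x"
        using ab \<open>\<alpha> > 0\<close> by (intro continuous_intros) auto
    qed (use 2 in simp)
    also have "\<dots> = expected_penalty \<alpha> a b p"
      using 2 by (simp add: expected_penalty_def power2_commute)
    finally show ?thesis .
  next
    case 3
    have "AE s in M. norm (X s) \<le> max \<bar>a\<bar> \<bar>b\<bar>"
      using bounds by eventually_elim auto
    then have int: "integrable M X" by (intro integrable_const_bound) auto
    have "expectation (\<lambda>s. min 0 ((X s - p) / \<alpha>)) = expectation (\<lambda>s. (X s - p) / \<alpha>)"
    proof (rule integral_cong_AE)
      show "AE s in M. min 0 ((X s - p) / \<alpha>) = (X s - p) / \<alpha>"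
        using bounds by eventually_elim (use 3 \<open>\<alpha> > 0\<close> in \<open>auto simp: min_def field_simps\<close>)
    qed auto
    also have "\<dots> = ((a + b) / 2 - p) / \<alpha>"
      using int uniform_distributed_expectation[OF D] by (simp add: prob_space)
    also have "\<dots> = expected_penalty \<alpha> a b p"
      using 3 ab by (simp add: expected_penalty_def)
    finally show ?thesis .
  qed
qed

section \<open>The limiting objective\<close>

definition limit_objective ::
  "real \<Rightarrow> real \<Rightarrow> real \<Rightarrow> real \<Rightarrow> real \<Rightarrow> real \<Rightarrow> real \<Rightarrow> real" where
  "limit_objective \<alpha> e1 e2 e3 a b p =
     g1 \<alpha> e1 e2 e3 ((a + b) / 2) p + expected_penalty \<alpha> a b p"

lemma f2_per_consumer:
  assumes "N > 0"
  shows "1 / real N * f2 \<alpha> e1 e2 e3 \<omega> N p =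
     e1 * (p * ((\<Sum>i<N. \<omega> i) / real N - p) / \<alpha>)
     - e2 * (((\<Sum>i<N. \<omega> i) / real N - p)\<^sup>2 / \<alpha>\<^sup>2) - e3 * (p\<^sup>2 / \<alpha>\<^sup>2)
     + (\<Sum>i<N. min 0 ((\<omega> i - p) / \<alpha>)) / real N"
proof -
  define m where "m = (\<Sum>i<N. \<omega> i) / real N"
  have "(\<Sum>i<N. \<omega> i) = real N * m" using assms by (simp add: m_def)
  then have usage: "(\<Sum>i<N. usage \<alpha> \<omega> p i) = real N * ((m - p) / \<alpha>)"
    by (simp add: usage_def sum_subtractf flip: sum_divide_distrib) (simp add: algebra_simps)
  have "f2 \<alpha> e1 e2 e3 \<omega> N p =
      e1 * (p * (real N * ((m - p) / \<alpha>))) - e2 / real N * (real N * ((m - p) / \<alpha>))\<^sup>2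
      - e3 * (real N * (p / \<alpha>)\<^sup>2) + (\<Sum>i<N. min 0 ((\<omega> i - p) / \<alpha>))"
    unfolding f2_def sum_distrib_left[symmetric] usage by simp
  also have "e2 / real N * (real N * ((m - p) / \<alpha>))\<^sup>2 = real N * (e2 * ((m - p)\<^sup>2 / \<alpha>\<^sup>2))"
    using assms by (simp add: power_mult_distrib power_divide power2_eq_square)
  finally show ?thesis
    using assms by (simp add: m_def[symmetric] power_divide add_divide_distrib diff_divide_distrib
        right_diff_distrib)
qed

lemma asymptotic_objective_limit_objective:
  assumes "prob_space M" "iid_uniform M W a b" "\<alpha> > 0"
  shows "asymptotic_objective M W \<alpha> e1 e2 e3 p\<^sub>b P (limit_objective \<alpha> e1 e2 e3 a b)"
  unfolding asymptotic_objective_def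
proof
  fix p
  interpret prob_space M by fact
  have indep: "indep_vars (\<lambda>_. borel) W UNIV"
    and D: "distributed M lborel (W i) (\<lambda>x. indicator {a..b} x / measure lborel {a..b})" for i
    using assms(2) by (auto simp: iid_uniform_def)
  let ?Y = "\<lambda>i s. min 0 ((W i s - p) / \<alpha>)"
  have law_W: "AE s in M. (\<lambda>n. (\<Sum>i<n. W i s) / real n) \<longlonglongrightarrow> (a + b) / 2"
    by (rule strong_law_bounded[OF indep uniform_AE_bounds[OF D]
          uniform_distributed_expectation[OF D]])
  have law_Y: "AE s in M. (\<lambda>n. (\<Sum>i<n. ?Y i s) / real n) \<longlonglongrightarrow> expected_penalty \<alpha> a b p"
  proof (rule strong_law_bounded)
    show "indep_vars (\<lambda>_. borel) ?Y UNIV"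
      by (rule indep_vars_compose2[OF indep]) measurable
    show "AE s in M. ?Y i s \<in> {min 0 ((a - p) / \<alpha>)..0}" for i
      using uniform_AE_bounds[OF D[of i]]
      by eventually_elim (use \<open>\<alpha> > 0\<close> in \<open>auto simp: min_def field_simps\<close>)
    show "expectation (?Y i) = expected_penalty \<alpha> a b p" for i
      by (rule uniform_expected_penalty[OF D \<open>\<alpha> > 0\<close>])
  qed
  from law_W law_Y
  show "AE s in M. (\<lambda>N. 1 / real N * f2 \<alpha> e1 e2 e3 (\<lambda>i. W i s) N p)
          \<longlonglongrightarrow> limit_objective \<alpha> e1 e2 e3 a b p"
  proof eventually_elim
    case (elim s)
    let ?m = "\<lambda>N. (\<Sum>i<N. W i s) / real N"
    have "(\<lambda>N. e1 * (p * (?m N - p) / \<alpha>) - e2 * ((?m N - p)\<^sup>2 / \<alpha>\<^sup>2) - e3 * (p\<^sup>2 / \<alpha>\<^sup>2)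
        + (\<Sum>i<N. ?Y i s) / real N) \<longlonglongrightarrow> limit_objective \<alpha> e1 e2 e3 a b p"
      unfolding limit_objective_def g1_def
      by (intro tendsto_intros elim) (use \<open>\<alpha> > 0\<close> in auto)
    then show ?case
    proof (rule Lim_transform_eventually)
      show "\<forall>\<^sub>F N in sequentially.
          e1 * (p * (?m N - p) / \<alpha>) - e2 * ((?m N - p)\<^sup>2 / \<alpha>\<^sup>2) - e3 * (p\<^sup>2 / \<alpha>\<^sup>2)
          + (\<Sum>i<N. ?Y i s) / real N = 1 / real N * f2 \<alpha> e1 e2 e3 (\<lambda>i. W i s) N p"
        using eventually_gt_at_top[of 0] by eventually_elim (simp only: f2_per_consumer)
    qed
  qed
qed

text \<open>Almost sure limits are unique on a probability space, which is never null; so optimality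
  can be tested on the limiting objective alone.\<close>

lemma asymptotic_objective_unique:
  assumes "prob_space M"
    and F: "asymptotic_objective M W \<alpha> e1 e2 e3 p\<^sub>b P F"
    and G: "asymptotic_objective M W \<alpha> e1 e2 e3 p\<^sub>b P G"
    and p: "p \<in> {p\<^sub>b..P}"
  shows "F p = G p"
proof -
  interpret prob_space M by fact
  have "AE s in M. F p = G p"
    using F[unfolded asymptotic_objective_def, rule_format, OF p]
      G[unfolded asymptotic_objective_def, rule_format, OF p]
    by eventually_elim (rule LIMSEQ_unique)
  then show ?thesis by simp
qed

lemma asymptotic_optimal_price_iff:
  assumes "prob_space M" "iid_uniform M W a b" "\<alpha> > 0"
  shows "asymptotic_optimal_price M W \<alpha> e1 e2 e3 p\<^sub>b P p \<longleftrightarrow>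
    is_arg_max (limit_objective \<alpha> e1 e2 e3 a b) (\<lambda>q. q \<in> {p\<^sub>b..P}) p"
proof -
  note lim = asymptotic_objective_limit_objective[OF assms]
  show ?thesis
    unfolding asymptotic_optimal_price_def is_arg_max_linorder
    using lim asymptotic_objective_unique[OF assms(1) _ lim] by metis
qed

section \<open>Maximising piece by piece\<close>

lemma limit_objective_left:
  "p \<le> a \<Longrightarrow> limit_objective \<alpha> e1 e2 e3 a b p = g1 \<alpha> e1 e2 e3 ((a + b) / 2) p"
  by (simp add: limit_objective_def expected_penalty_def)

lemma limit_objective_middle:
  "a \<le> p \<Longrightarrow> p \<le> b \<Longrightarrow>
    limit_objective \<alpha> e1 e2 e3 a b p = g2 \<alpha> e1 e2 e3 ((a + b) / 2) a b p"
  by (auto simp: limit_objective_def expected_penalty_def g1_def g2_def)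

lemma g1_antimono_above_mean:
  assumes "\<alpha> > 0" "e1 \<ge> 0" "e2 \<ge> 0" "e3 \<ge> 0" "0 \<le> q" "m \<le> q" "q \<le> p"
  shows "g1 \<alpha> e1 e2 e3 m p \<le> g1 \<alpha> e1 e2 e3 m q"
proof -
  have "p * (m - p) \<le> q * (m - q)"
  proof -
    have "q * (m - q) - p * (m - p) = (p - q) * (p + q - m)" by algebra
    moreover have "0 \<le> (p - q) * (p + q - m)"
      using assms by (intro mult_nonneg_nonneg) auto
    ultimately show ?thesis by linarith
  qed
  moreover have "(m - q)\<^sup>2 \<le> (m - p)\<^sup>2"
    using power_mono[of "q - m" "p - m" 2] assms by (simp add: power2_commute)
  moreover have "q\<^sup>2 \<le> p\<^sup>2" using assms by (intro power_mono) auto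
  ultimately show ?thesis
    unfolding g1_def using assms
    by (intro diff_mono mult_left_mono divide_right_mono) auto
qed

lemma g2_above_less:
  assumes "\<alpha> > 0" "e1 \<ge> 0" "e2 \<ge> 0" "e3 \<ge> 0" "0 \<le> b" "a < b" "b < p"
  shows "g2 \<alpha> e1 e2 e3 ((a + b) / 2) a b p < g2 \<alpha> e1 e2 e3 ((a + b) / 2) a b b"
proof -
  have "(b - a)\<^sup>2 / (2 * \<alpha> * (b - a)) < (p - a)\<^sup>2 / (2 * \<alpha> * (b - a))"
    using assms by (intro divide_strict_right_mono power_strict_mono) auto
  moreover have "g1 \<alpha> e1 e2 e3 ((a + b) / 2) p \<le> g1 \<alpha> e1 e2 e3 ((a + b) / 2) b"
    using assms by (intro g1_antimono_above_mean) auto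
  ultimately show ?thesis unfolding g1_def g2_def by linarith
qed

lemma limit_objective_above_less:
  assumes "\<alpha> > 0" "e1 \<ge> 0" "e2 \<ge> 0" "e3 \<ge> 0" "0 \<le> b" "a < b" "b < p"
  shows "limit_objective \<alpha> e1 e2 e3 a b p < limit_objective \<alpha> e1 e2 e3 a b b"
proof -
  have "expected_penalty \<alpha> a b b = ((a + b) / 2 - b) / \<alpha>"
    using assms by (simp add: expected_penalty_def field_simps power2_eq_square)
  moreover have "expected_penalty \<alpha> a b p = ((a + b) / 2 - p) / \<alpha>"
    using assms by (simp add: expected_penalty_def)
  moreover have "((a + b) / 2 - p) / \<alpha> < ((a + b) / 2 - b) / \<alpha>"
    by (rule divide_strict_right_mono) (use assms in linarith)+
  ultimately have "expected_penalty \<alpha> a b p < expected_penalty \<alpha> a b b" by simp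
  moreover have "g1 \<alpha> e1 e2 e3 ((a + b) / 2) p \<le> g1 \<alpha> e1 e2 e3 ((a + b) / 2) b"
    using assms by (intro g1_antimono_above_mean) auto
  ultimately show ?thesis unfolding limit_objective_def by linarith
qed

lemma g2_eq_g1_minus:
  "g2 \<alpha> e1 e2 e3 m a b p = g1 \<alpha> e1 e2 e3 m p - (p - a)\<^sup>2 / (2 * \<alpha> * (b - a))"
  by (simp add: g1_def g2_def)

lemma g1_between_ge:
  assumes "\<alpha> > 0" "e1 \<ge> 0" "e2 \<ge> 0" "e3 \<ge> 0" "x \<le> z" "z \<le> y"
  shows "min (g1 \<alpha> e1 e2 e3 m x) (g1 \<alpha> e1 e2 e3 m y) \<le> g1 \<alpha> e1 e2 e3 m z"
proof (cases "x = y")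
  case False
  \<comment> \<open>\<open>g1\<close> is a quadratic polynomial with leading coefficient \<open>- c \<le> 0\<close>.\<close>
  define c where "c = e1 / \<alpha> + e2 / \<alpha>\<^sup>2 + e3 / \<alpha>\<^sup>2"
  define l where "l = e1 * m / \<alpha> + 2 * e2 * m / \<alpha>\<^sup>2"
  define k where "k = e2 * m\<^sup>2 / \<alpha>\<^sup>2"
  have g1: "g1 \<alpha> e1 e2 e3 m t = - c * t\<^sup>2 + l * t - k" for t
    using \<open>\<alpha> > 0\<close> unfolding g1_def c_def l_def k_def
    by (simp add: field_simps power2_eq_square)
  have "c \<ge> 0" using assms by (simp add: c_def)
  have chord: "(y - x) * g1 \<alpha> e1 e2 e3 m z =
      (y - z) * g1 \<alpha> e1 e2 e3 m x + (z - x) * g1 \<alpha> e1 e2 e3 m y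
      + c * (y - x) * (y - z) * (z - x)"
    unfolding g1 by algebra
  let ?v = "min (g1 \<alpha> e1 e2 e3 m x) (g1 \<alpha> e1 e2 e3 m y)"
  have "(y - x) * ?v = (y - z) * ?v + (z - x) * ?v" by algebra
  also have "\<dots> \<le> (y - z) * g1 \<alpha> e1 e2 e3 m x + (z - x) * g1 \<alpha> e1 e2 e3 m y"
    using assms by (intro add_mono mult_left_mono) auto
  also have "\<dots> \<le> (y - x) * g1 \<alpha> e1 e2 e3 m z"
    unfolding chord using assms \<open>c \<ge> 0\<close> by simp
  finally show ?thesis using False assms by simp
qed (use assms in auto)

text \<open>Here \<open>g1\<close> is at least the common value \<open>v\<close> at \<open>pl\<close> and, dominating \<open>g2\<close>, also at \<open>pr\<close>. By
  concavity it is at least \<open>v\<close> at the junction \<open>a\<close> in between, where the two functions agree.\<close>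

lemma tie_at_junction:
  assumes "\<alpha> > 0" "e1 \<ge> 0" "e2 \<ge> 0" "e3 \<ge> 0" "a < b"
    and pl: "is_arg_max (g1 \<alpha> e1 e2 e3 m) (\<lambda>p. p \<in> {p\<^sub>b..a}) pl"
    and pr: "is_arg_max (g2 \<alpha> e1 e2 e3 m a b) (\<lambda>p. p \<in> {a..P}) pr"
    and tie: "g1 \<alpha> e1 e2 e3 m pl = g2 \<alpha> e1 e2 e3 m a b pr"
  shows "is_arg_max (g1 \<alpha> e1 e2 e3 m) (\<lambda>p. p \<in> {p\<^sub>b..a}) a"
    and "is_arg_max (g2 \<alpha> e1 e2 e3 m a b) (\<lambda>p. p \<in> {a..P}) a"
proof -
  have "g2 \<alpha> e1 e2 e3 m a b pr \<le> g1 \<alpha> e1 e2 e3 m pr"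
    using assms(1,5) by (simp add: g2_eq_g1_minus)
  moreover have "min (g1 \<alpha> e1 e2 e3 m pl) (g1 \<alpha> e1 e2 e3 m pr) \<le> g1 \<alpha> e1 e2 e3 m a"
    using pl pr assms(1-4) by (intro g1_between_ge) (auto simp: is_arg_max_linorder)
  ultimately have junction: "g1 \<alpha> e1 e2 e3 m pl \<le> g1 \<alpha> e1 e2 e3 m a" using tie by simp
  then show "is_arg_max (g1 \<alpha> e1 e2 e3 m) (\<lambda>p. p \<in> {p\<^sub>b..a}) a"
    using pl by (fastforce simp: is_arg_max_linorder)
  have "g2 \<alpha> e1 e2 e3 m a b a = g1 \<alpha> e1 e2 e3 m a" by (simp add: g2_eq_g1_minus)
  then show "is_arg_max (g2 \<alpha> e1 e2 e3 m a b) (\<lambda>p. p \<in> {a..P}) a"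
    using pr junction tie by (fastforce simp: is_arg_max_linorder)
qed

text \<open>An optimal price is never above \<open>b\<close>, so it lies in one of the two pieces and, attaining the
  larger of the two maxima, is a maximiser of that piece.\<close>

lemma limit_objective_arg_max_iff:
  assumes pos: "\<alpha> > 0" "e1 \<ge> 0" "e2 \<ge> 0" "e3 \<ge> 0" and "0 \<le> p\<^sub>b" "a < b" and m: "m = (a + b) / 2"
    and pl: "is_arg_max (g1 \<alpha> e1 e2 e3 m) (\<lambda>p. p \<in> {p\<^sub>b..a}) pl"
    and pr: "is_arg_max (g2 \<alpha> e1 e2 e3 m a b) (\<lambda>p. p \<in> {a..P}) pr"
  shows "is_arg_max (limit_objective \<alpha> e1 e2 e3 a b) (\<lambda>p. p \<in> {p\<^sub>b..P}) q \<longleftrightarrow>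
    is_arg_max (g1 \<alpha> e1 e2 e3 m) (\<lambda>p. p \<in> {p\<^sub>b..a}) q
      \<and> g2 \<alpha> e1 e2 e3 m a b pr \<le> g1 \<alpha> e1 e2 e3 m pl
    \<or> is_arg_max (g2 \<alpha> e1 e2 e3 m a b) (\<lambda>p. p \<in> {a..P}) q
      \<and> g1 \<alpha> e1 e2 e3 m pl \<le> g2 \<alpha> e1 e2 e3 m a b pr"
proof -
  let ?F = "limit_objective \<alpha> e1 e2 e3 a b" and ?g1 = "g1 \<alpha> e1 e2 e3 m" and ?g2 = "g2 \<alpha> e1 e2 e3 m a b"
  have pl': "pl \<in> {p\<^sub>b..a}" "\<And>x. x \<in> {p\<^sub>b..a} \<Longrightarrow> ?g1 x \<le> ?g1 pl"
    and pr': "pr \<in> {a..P}" "\<And>x. x \<in> {a..P} \<Longrightarrow> ?g2 x \<le> ?g2 pr"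
    using pl pr by (auto simp: is_arg_max_linorder)
  have "0 \<le> b" "p\<^sub>b \<le> a" "a \<le> P" using assms(5,6) pl'(1) pr'(1) by auto
  note above = pos \<open>0 \<le> b\<close> \<open>a < b\<close>
  have left: "?F x = ?g1 x" if "x \<le> a" for x
    using that by (simp add: m limit_objective_left)
  have middle: "?F x = ?g2 x" if "a \<le> x" "x \<le> b" for x
    using that by (simp add: m limit_objective_middle)
  have F_above: "?F x < ?g2 pr" if "b < x" "x \<le> P" for x
    using limit_objective_above_less[OF above that(1)] middle[of b] pr'(2)[of b] that \<open>a < b\<close> by force
  have g2_above: "?g2 x < ?g2 pr" if "b < x" "x \<le> P" for x
    using g2_above_less[OF above that(1)] pr'(2)[of b] that \<open>a < b\<close> by (force simp: m)
  have F_le: "?F x \<le> max (?g1 pl) (?g2 pr)" if "x \<in> {p\<^sub>b..P}" for x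
    using that left[of x] middle[of x] F_above[of x] pl'(2)[of x] pr'(2)[of x]
    by (cases "x \<le> a"; cases "x \<le> b") (auto simp: le_max_iff_disj)
  have "pr \<le> b" using g2_above[of pr] pr'(1) by force
  then have F_at: "?F pl = ?g1 pl" "?F pr = ?g2 pr"
    using left middle pl'(1) pr'(1) by auto
  have in_pb: "pl \<in> {p\<^sub>b..P}" "pr \<in> {p\<^sub>b..P}"
    using pl'(1) pr'(1) \<open>p\<^sub>b \<le> a\<close> \<open>a \<le> P\<close> by auto
  have optimal_value: "is_arg_max ?F (\<lambda>p. p \<in> {p\<^sub>b..P}) q \<longleftrightarrow>
      q \<in> {p\<^sub>b..P} \<and> ?F q = max (?g1 pl) (?g2 pr)"
    unfolding is_arg_max_linorder using F_le F_at in_pb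
    by (metis max_def order_antisym max.boundedI)
  have max1: "is_arg_max ?g1 (\<lambda>p. p \<in> {p\<^sub>b..a}) q \<longleftrightarrow> q \<in> {p\<^sub>b..a} \<and> ?g1 q = ?g1 pl"
    using pl' by (auto simp: is_arg_max_linorder intro: antisym)
  have max2: "is_arg_max ?g2 (\<lambda>p. p \<in> {a..P}) q \<longleftrightarrow> q \<in> {a..P} \<and> ?g2 q = ?g2 pr"
    using pr' by (auto simp: is_arg_max_linorder intro: antisym)
  show ?thesis
    unfolding optimal_value max1 max2
  proof (cases "q \<le> a")
    case True
    \<comment> \<open>The two pieces overlap in \<open>a\<close> itself, where both formulas apply.\<close>
    have "?g2 q = ?g1 q" if "q = a" using left[of a] middle[of a] that \<open>a < b\<close> by simp
    then show "(q \<in> {p\<^sub>b..P} \<and> ?F q = max (?g1 pl) (?g2 pr)) \<longleftrightarrow>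
        (q \<in> {p\<^sub>b..a} \<and> ?g1 q = ?g1 pl) \<and> ?g2 pr \<le> ?g1 pl \<or>
        (q \<in> {a..P} \<and> ?g2 q = ?g2 pr) \<and> ?g1 pl \<le> ?g2 pr"
      using True left[of q] pl'(2)[of q] pr'(2)[of q] \<open>p\<^sub>b \<le> a\<close> \<open>a \<le> P\<close> F_le[of q] F_at
      by (auto simp: max_def split: if_splits)
  next
    case False
    then show "(q \<in> {p\<^sub>b..P} \<and> ?F q = max (?g1 pl) (?g2 pr)) \<longleftrightarrow>
        (q \<in> {p\<^sub>b..a} \<and> ?g1 q = ?g1 pl) \<and> ?g2 pr \<le> ?g1 pl \<or>
        (q \<in> {a..P} \<and> ?g2 q = ?g2 pr) \<and> ?g1 pl \<le> ?g2 pr"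
      using middle[of q] F_above[of q] g2_above[of q] pr'(2)[of q] \<open>p\<^sub>b \<le> a\<close>
      by (cases "q \<le> b") (auto simp: max_def split: if_splits)
  qed
qed

section \<open>The optimal price\<close>

theorem mainTheorem6:
  fixes M :: "'s measure"
    and W :: "nat \<Rightarrow> 's \<Rightarrow> real"
    and \<alpha> e1 e2 e3 p\<^sub>b P \<omega>min \<omega>max \<omega>bar pl pr :: real
  assumes "prob_space M"
    and "\<omega>min < \<omega>max"
    and "iid_uniform M W \<omega>min \<omega>max"
    and "\<And>i. prob_space.expectation M (W i) = \<omega>bar"
    and "\<alpha> > 0" and "e1 \<ge> 0" and "e2 \<ge> 0" and "e3 \<ge> 0" and "p\<^sub>b \<ge> 0"
    and "is_arg_max (g1 \<alpha> e1 e2 e3 \<omega>bar) (\<lambda>p. p \<in> {p\<^sub>b..\<omega>min}) pl"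
    and "is_arg_max (g2 \<alpha> e1 e2 e3 \<omega>bar \<omega>min \<omega>max) (\<lambda>p. p \<in> {\<omega>min..P}) pr"
  shows "asymptotic_optimal_price M W \<alpha> e1 e2 e3 p\<^sub>b P
           (if g1 \<alpha> e1 e2 e3 \<omega>bar pl > g2 \<alpha> e1 e2 e3 \<omega>bar \<omega>min \<omega>max pr then pl else pr)
       \<and> ((\<exists>!p. is_arg_max (g1 \<alpha> e1 e2 e3 \<omega>bar) (\<lambda>p. p \<in> {p\<^sub>b..\<omega>min}) p)
            \<and> (\<exists>!p. is_arg_max (g2 \<alpha> e1 e2 e3 \<omega>bar \<omega>min \<omega>max) (\<lambda>p. p \<in> {\<omega>min..P}) p)
          \<longrightarrow> (\<forall>p. asymptotic_optimal_price M W \<alpha> e1 e2 e3 p\<^sub>b P p \<longleftrightarrow>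
                p = (if g1 \<alpha> e1 e2 e3 \<omega>bar pl > g2 \<alpha> e1 e2 e3 \<omega>bar \<omega>min \<omega>max pr
                     then pl else pr)))"
proof -
  interpret prob_space M by fact
  let ?g1 = "g1 \<alpha> e1 e2 e3 \<omega>bar" and ?g2 = "g2 \<alpha> e1 e2 e3 \<omega>bar \<omega>min \<omega>max"
  let ?left = "is_arg_max ?g1 (\<lambda>p. p \<in> {p\<^sub>b..\<omega>min})"
    and ?right = "is_arg_max ?g2 (\<lambda>p. p \<in> {\<omega>min..P})"
  have "\<omega>bar = (\<omega>min + \<omega>max) / 2"
    using assms(3) assms(4)[of 0] uniform_distributed_expectation[of "W 0" \<omega>min \<omega>max]
    by (simp add: iid_uniform_def)
  from limit_objective_arg_max_iff[OF assms(5-9) assms(2) this assms(10,11)]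
  have optimal_iff: "asymptotic_optimal_price M W \<alpha> e1 e2 e3 p\<^sub>b P p \<longleftrightarrow>
      ?left p \<and> ?g2 pr \<le> ?g1 pl \<or> ?right p \<and> ?g1 pl \<le> ?g2 pr" for p
    using asymptotic_optimal_price_iff[OF assms(1,3,5)] by simp
  note junction = tie_at_junction[OF assms(5-8) assms(2) assms(10,11)]
  show ?thesis
  proof (intro conjI impI allI)
    show "asymptotic_optimal_price M W \<alpha> e1 e2 e3 p\<^sub>b P (if ?g1 pl > ?g2 pr then pl else pr)"
      using assms(10,11) unfolding optimal_iff by auto
    fix p
    assume unique: "(\<exists>!p. ?left p) \<and> (\<exists>!p. ?right p)"
    have left: "p = pl" if "?left p" using unique assms(10) that by blast
    have right: "p = pr" if "?right p" using unique assms(11) that by blast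
    have tie: "pl = pr" if "?g1 pl = ?g2 pr"
      using unique junction[OF that] assms(10,11) by blast
    show "asymptotic_optimal_price M W \<alpha> e1 e2 e3 p\<^sub>b P p \<longleftrightarrow>
        p = (if ?g1 pl > ?g2 pr then pl else pr)"
      unfolding optimal_iff using left right tie assms(10,11)
      by (cases "?g1 pl" "?g2 pr" rule: linorder_cases) auto
  qed
qed

end
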